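(* Let $p$ be a prime, $n\ge 1$, and let $f:\mathbb{F}_{p^n}\to\mathbb{F}_p$ be cubic-like bent, i.e. for every $a\in\mathbb{F}_{p^n}^*$ there exists $b\in\mathbb{F}_{p^n}$ such that the second-order derivative $D_{a,b}f(x)=f(x+a+b)-f(x+a)-f(x+b)+f(x)$ is a nonzero constant function of $x$. Then $f$ is bent; equivalently, $f$ is perfect nonlinear, i.e. every first-order derivative $D_af(x)=f(x+a)-f(x)$ with $a\neq 0$ is balanced.
   Context: Let $\omega=e^{2\pi i/p}$ and $\mathrm{Tr}_n(x)=\sum_{i=0}^{n-1}x^{p^i}$ be the absolute trace of $\mathbb{F}_{p^n}$. The Walsh transform of $g:\mathbb{F}_{p^n}\to\mathbb{F}_p$ is $W_g(y)=\sum_{x\in\mathbb{F}_{p^n}}\omega^{g(x)-\mathrm{Tr}_n(xy)}$ (elements of $\mathbb{F}_p$ viewed as integers mod $p$). A function $f$ is bent if $|W_f(y)|^2=p^n$ for all $y\in\mathbb{F}_{p^n}$. A function is balanced if it takes every value of $\mathbb{F}_p$ equally often. *)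

theory Defs
  imports
    "HOL-Analysis.Analysis"
    "Berlekamp_Zassenhaus.Finite_Field"
begin

text \<open>
  The prime field with \<open>p\<close> elements is \<open>'p mod_ring\<close> with \<open>'p :: prime_card\<close> and \<open>p = CARD('p)\<close>;
  the field with \<open>p ^ n\<close> elements is any \<open>'q :: finite_field\<close> with \<open>CARD('q) = CARD('p) ^ n\<close>.
  As these are distinct types, the inclusion of the prime field is an explicit map.
\<close>

definition prime_incl :: "'p::prime_card mod_ring \<Rightarrow> 'q::finite_field" where
  "prime_incl c = of_int (to_int_mod_ring c)"

definition abs_trace :: "nat \<Rightarrow> 'q::finite_field \<Rightarrow> 'p::prime_card mod_ring" where
  "abs_trace n x = (THE c. prime_incl c = (\<Sum>i<n. x ^ (CARD('p) ^ i)))"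

text \<open>
  The following lemmas show that the definite description in \<open>abs_trace\<close> denotes, i.e. that the
  trace sum is the image of exactly one element of the prime field.
\<close>

lemma CHAR_finite_field_eq:
  assumes "CARD('q::finite_field) = CARD('p::prime_card) ^ n"
  shows "CHAR('q) = CARD('p)"
proof -
  have "CHAR('q) dvd CARD('p) ^ n"
    using CHAR_dvd_CARD[where 'a = 'q] assms by simp
  moreover have "prime CHAR('q)" by simp
  ultimately show ?thesis
    using prime_card[where 'a = 'p] prime_dvd_power primes_dvd_imp_eq by blast
qed

lemma inj_prime_incl:
  assumes "CHAR('q::finite_field) = CARD('p::prime_card)"
  shows "inj (prime_incl :: 'p mod_ring \<Rightarrow> 'q)"
proof (rule injI)
  fix c d :: "'p mod_ring"
  assume "prime_incl c = (prime_incl d :: 'q)"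
  then have "[to_int_mod_ring c = to_int_mod_ring d] (mod int CARD('p))"
    by (simp add: prime_incl_def of_int_eq_iff_cong_CHAR assms)
  moreover have "to_int_mod_ring c \<in> {0..<int CARD('p)}" "to_int_mod_ring d \<in> {0..<int CARD('p)}"
    using range_to_int_mod_ring[where 'a = 'p] by blast+
  ultimately have "to_int_mod_ring c = to_int_mod_ring d"
    by (simp add: cong_def)
  then show "c = d" by simp
qed

lemma range_prime_incl:
  assumes char: "CHAR('q::finite_field) = CARD('p::prime_card)"
  shows "range (prime_incl :: 'p mod_ring \<Rightarrow> 'q) = {y. y ^ CARD('p) = y}"
proof (rule card_seteq)
  let ?p = "CARD('p)"
  let ?f = "Polynomial.monom 1 ?p - Polynomial.monom 1 1 :: 'q poly"
  have p: "?p > 1" using prime_card[where 'a = 'p] prime_gt_1_nat by blast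
  show "finite {y::'q. y ^ ?p = y}" by simp
  show "range (prime_incl :: 'p mod_ring \<Rightarrow> 'q) \<subseteq> {y. y ^ ?p = y}"
  proof
    fix y :: 'q assume "y \<in> range (prime_incl :: 'p mod_ring \<Rightarrow> 'q)"
    then obtain c :: "'p mod_ring" where y: "y = of_int (to_int_mod_ring c)"
      by (auto simp: prime_incl_def)
    have "to_int_mod_ring c \<in> {0..<int CARD('p)}"
      using range_to_int_mod_ring[where 'a = 'p] by blast
    then obtain k where k: "to_int_mod_ring c = int k"
      using nonneg_int_cases by auto
    have "(of_nat k :: 'q) ^ ?p = of_nat k"
    proof (induction k)
      case 0
      then show ?case using p by simp
    next
      case (Suc k)
      have "(1 + of_nat k :: 'q) ^ ?p = 1 ^ ?p + of_nat k ^ ?p"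
        by (rule freshmans_dream) (simp_all add: char prime_card)
      then show ?case using Suc by simp
    qed
    then show "y \<in> {y. y ^ ?p = y}" using y k by simp
  qed
  have "Polynomial.coeff ?f ?p = 1" using p by simp
  then have nz: "?f \<noteq> 0" by (metis Polynomial.coeff_0 zero_neq_one)
  have "{y::'q. y ^ ?p = y} = {y. poly ?f y = 0}" by (simp add: poly_monom)
  then have "card {y::'q. y ^ ?p = y} \<le> Polynomial.degree ?f"
    using card_poly_roots_bound[OF nz] by simp
  also have "\<dots> \<le> ?p"
    using p by (intro Polynomial.degree_diff_le) (auto intro: order.trans[OF Polynomial.degree_monom_le])
  also have "\<dots> = card (range (prime_incl :: 'p mod_ring \<Rightarrow> 'q))"
    by (simp add: card_image inj_prime_incl[OF char])
  finally show "card {y::'q. y ^ ?p = y} \<le> card (range (prime_incl :: 'p mod_ring \<Rightarrow> 'q))" .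
qed

lemma prime_incl_abs_trace:
  fixes x :: "'q::finite_field"
  assumes card: "CARD('q) = CARD('p::prime_card) ^ n"
  shows "prime_incl (abs_trace n x :: 'p mod_ring) = (\<Sum>i<n. x ^ (CARD('p) ^ i))"
proof -
  let ?p = "CARD('p)"
  let ?t = "\<Sum>i<n. x ^ (?p ^ i)"
  have char: "CHAR('q) = ?p" by (rule CHAR_finite_field_eq[OF card])
  have xn: "x ^ (?p ^ n) = x"
    using finite_field_power_card_eq_same[of x] card by simp
  have "?t ^ ?p = (\<Sum>i<n. (x ^ (?p ^ i)) ^ ?p)"
    by (rule freshmans_dream_sum) (simp_all add: char prime_card)
  also have "\<dots> = (\<Sum>i<n. x ^ (?p ^ Suc i))"
    by (simp add: power_mult [symmetric] mult.commute)
  also have "\<dots> = ?t"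
    using sum.lessThan_Suc_shift[of "\<lambda>i. x ^ (?p ^ i)" n]
      sum.lessThan_Suc[of "\<lambda>i. x ^ (?p ^ i)" n] xn
    by simp
  finally have "?t \<in> range (prime_incl :: 'p mod_ring \<Rightarrow> 'q)"
    by (simp add: range_prime_incl[OF char])
  then obtain c :: "'p mod_ring" where c: "prime_incl c = ?t" by auto
  show ?thesis unfolding abs_trace_def
  proof (rule theI)
    show "prime_incl c = ?t" by (rule c)
    show "d = c" if "prime_incl d = ?t" for d :: "'p mod_ring"
      using that c inj_prime_incl[OF char] by (metis injD)
  qed
qed

definition walsh :: "nat \<Rightarrow> ('q::finite_field \<Rightarrow> 'p::prime_card mod_ring) \<Rightarrow> 'q \<Rightarrow> complex" where
  "walsh n g y =
    (\<Sum>x\<in>UNIV. exp (2 * pi * \<i> / CARD('p)) powi to_int_mod_ring (g x - abs_trace n (x * y)))"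

definition bent :: "nat \<Rightarrow> ('q::finite_field \<Rightarrow> 'p::prime_card mod_ring) \<Rightarrow> bool" where
  "bent n f \<longleftrightarrow> (\<forall>y. (cmod (walsh n f y))\<^sup>2 = real (CARD('p) ^ n))"

definition balanced :: "('q::finite_field \<Rightarrow> 'p::prime_card mod_ring) \<Rightarrow> bool" where
  "balanced g \<longleftrightarrow> (\<forall>c d. card {x. g x = c} = card {x. g x = d})"

definition deriv1 ::
  "'q::finite_field \<Rightarrow> ('q \<Rightarrow> 'p::prime_card mod_ring) \<Rightarrow> 'q \<Rightarrow> 'p mod_ring" where
  "deriv1 a f x = f (x + a) - f x"

definition deriv2 ::
  "'q::finite_field \<Rightarrow> 'q \<Rightarrow> ('q \<Rightarrow> 'p::prime_card mod_ring) \<Rightarrow> 'q \<Rightarrow> 'p mod_ring" where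
  "deriv2 a b f x = f (x + a + b) - f (x + a) - f (x + b) + f x"

definition cubic_like_bent :: "('q::finite_field \<Rightarrow> 'p::prime_card mod_ring) \<Rightarrow> bool" where
  "cubic_like_bent f \<longleftrightarrow> (\<forall>a. a \<noteq> 0 \<longrightarrow> (\<exists>b c. c \<noteq> 0 \<and> (\<forall>x. deriv2 a b f x = c)))"

definition perfect_nonlinear :: "('q::finite_field \<Rightarrow> 'p::prime_card mod_ring) \<Rightarrow> bool" where
  "perfect_nonlinear f \<longleftrightarrow> (\<forall>a. a \<noteq> 0 \<longrightarrow> balanced (deriv1 a f))"

end

theory Submission
  imports Defs
begin

text \<open>
  If \<open>D\<^sub>a\<^sub>,\<^sub>b f\<close> is the nonzero constant \<open>c\<close>, then translation by \<open>b\<close> adds \<open>c\<close> to every value of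
  \<open>D\<^sub>a f\<close>. Hence all fibres of \<open>D\<^sub>a f\<close> are equinumerous, because \<open>c\<close> generates the prime field, and
  the sum of \<open>\<omega>\<close> to the values of \<open>D\<^sub>a f\<close> is invariant under multiplication by \<open>\<omega>\<^sup>c \<noteq> 1\<close>, so it
  vanishes. In the expansion of the squared modulus of the Walsh transform along \<open>x = z + a\<close> only
  the summand \<open>a = 0\<close> therefore survives.
\<close>

lemma to_int_mod_ring_add_cong:
  "[to_int_mod_ring (a + b) = to_int_mod_ring a + to_int_mod_ring b] (mod int CARD('p))"
  for a b :: "'p::prime_card mod_ring"
  by (simp add: cong_def to_int_mod_ring_add)

lemma prime_incl_add:
  assumes "CHAR('q::finite_field) = CARD('p::prime_card)"
  shows "(prime_incl (c + d :: 'p mod_ring) :: 'q) = prime_incl c + prime_incl d"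
  using to_int_mod_ring_add_cong[of c d]
  by (simp add: prime_incl_def of_int_eq_iff_cong_CHAR assms flip: of_int_add)

text \<open>Powers of the Frobenius map are additive in characteristic \<open>p\<close>. Since the
  trace is given by a description, the identity is proved for its image in the large field and
  pulled back by injectivity of \<open>prime_incl\<close>.\<close>

lemma abs_trace_add:
  fixes x y :: "'q::finite_field"
  assumes card: "CARD('q) = CARD('p::prime_card) ^ n"
  shows "(abs_trace n (x + y) :: 'p mod_ring) = abs_trace n x + abs_trace n y"
proof -
  have char: "CHAR('q) = CARD('p)" by (rule CHAR_finite_field_eq[OF card])
  have "(x + y) ^ (CARD('p) ^ i) = x ^ (CARD('p) ^ i) + y ^ (CARD('p) ^ i)" for i
    by (rule freshmans_dream'[where n = i]) (simp_all add: char prime_card)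
  then have "(prime_incl (abs_trace n (x + y) :: 'p mod_ring) :: 'q) =
      prime_incl (abs_trace n x + abs_trace n y :: 'p mod_ring)"
    by (simp add: prime_incl_add[OF char] prime_incl_abs_trace[OF card] sum.distrib)
  then show ?thesis using inj_prime_incl[OF char] by (simp add: inj_eq)
qed

text \<open>The canonical additive character of the prime field, so that the Walsh transform becomes
  a character sum.\<close>

definition add_char :: "'p::prime_card mod_ring \<Rightarrow> complex" where
  "add_char c = exp (2 * pi * \<i> / CARD('p)) powi to_int_mod_ring c"

text \<open>The complex exponential has period 2 pi i. The direction from right to left makes
  \<open>add_char\<close> independent of integer representatives, hence multiplicative; the other
  one makes it nontrivial away from 0.\<close>

lemma exp_powi_eq_iff_cong:
  assumes "m > 0"
  shows "exp (2 * pi * \<i> / real m) powi j = exp (2 * pi * \<i> / real m) powi k \<longleftrightarrow>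
    [j = k] (mod int m)"
proof -
  have "exp (2 * pi * \<i> / real m) powi j = exp (2 * pi * \<i> / real m) powi k \<longleftrightarrow>
      (\<exists>l::int. (2 * pi * \<i>) * of_int j = (2 * pi * \<i>) * of_int (k + int m * l))"
    using assms by (simp add: exp_power_int exp_eq field_simps)
  also have "\<dots> \<longleftrightarrow> (\<exists>l. j = k + int m * l)"
    by (simp only: mult_cancel_left of_int_eq_iff) simp
  also have "\<dots> \<longleftrightarrow> [j = k] (mod int m)"
    by (metis cong_iff_lin cong_sym)
  finally show ?thesis .
qed

lemma add_char_add: "add_char (c + d) = add_char c * add_char d"
  for c d :: "'p::prime_card mod_ring"
proof -
  have "add_char (c + d) =
      exp (2 * pi * \<i> / CARD('p)) powi (to_int_mod_ring c + to_int_mod_ring d)"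
    unfolding add_char_def
    using to_int_mod_ring_add_cong[of c d] exp_powi_eq_iff_cong[of "CARD('p)"] by simp
  then show ?thesis by (simp add: add_char_def power_int_add)
qed

lemma add_char_0 [simp]: "add_char 0 = 1"
  by (simp add: add_char_def)

lemma add_char_eq_1_iff: "add_char c = 1 \<longleftrightarrow> c = 0"
  for c :: "'p::prime_card mod_ring"
proof -
  have "add_char c = 1 \<longleftrightarrow> [to_int_mod_ring c = 0] (mod int CARD('p))"
    using exp_powi_eq_iff_cong[of "CARD('p)" _ 0] by (simp add: add_char_def)
  moreover have "to_int_mod_ring c \<in> {0..<int CARD('p)}"
    using range_to_int_mod_ring[where 'a = 'p] by blast
  ultimately show ?thesis by (simp add: cong_def)
qed

lemma norm_add_char [simp]: "cmod (add_char c) = 1"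
  by (simp add: add_char_def norm_power_int)

text \<open>Both sides are inverse to \<open>add_char c\<close>, the right one because the modulus
  is 1.\<close>

lemma add_char_minus: "add_char (- c) = cnj (add_char c)"
proof -
  have "add_char (- c) * add_char c = cnj (add_char c) * add_char c"
    using complex_norm_square[of "add_char c"] by (simp flip: add_char_add add: mult.commute)
  moreover have "add_char c \<noteq> 0" using norm_add_char[of c] by force
  ultimately show ?thesis by simp
qed

lemma add_char_diff: "add_char (c - d) = add_char c * cnj (add_char d)"
  using add_char_add[of c "- d"] by (simp add: add_char_minus)

lemma bij_add_right: "bij (\<lambda>x::'q::group_add. x + b)"
  by (rule bij_betw_byWitness[where f' = "\<lambda>x. x - b"]) auto

lemma balanced_if_shift:
  fixes g :: "'q::finite_field \<Rightarrow> 'p::prime_card mod_ring"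
  assumes "c \<noteq> 0" and shift: "\<And>x. g (x + b) = g x + c"
  shows "balanced g"
proof -
  have shift_back: "g (x - b) = g x - c" for x
    using shift[of "x - b"] by simp
  have step: "card {x. g x = v + c} = card {x. g x = v}" for v
  proof (rule bij_betw_same_card[symmetric])
    show "bij_betw (\<lambda>x. x + b) {x. g x = v} {x. g x = v + c}"
      using shift_back by (intro bij_betw_byWitness[where f' = "\<lambda>x. x - b"]) (auto simp: shift)
  qed
  have steps: "card {x. g x = v + of_nat k * c} = card {x. g x = v}" for v k
  proof (induction k)
    case (Suc k)
    then show ?case using step[of "v + of_nat k * c"] by (simp add: algebra_simps)
  qed simp
  show ?thesis unfolding balanced_def
  proof (intro allI)
    fix v w
    \<comment> \<open>Every element of the prime field is a multiple of 1, so \<open>k\<close>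
      counts the shifts by \<open>c\<close> leading from \<open>w\<close> to
      \<open>v\<close>.\<close>
    obtain k where "(v - w) / c = of_nat k"
      using surj_of_nat_mod_ring by blast
    then have "v = w + of_nat k * c" using \<open>c \<noteq> 0\<close> by (simp add: field_simps)
    then show "card {x. g x = v} = card {x. g x = w}" using steps by simp
  qed
qed

lemma sum_add_char_eq_0_if_shift:
  fixes g :: "'q::finite_field \<Rightarrow> 'p::prime_card mod_ring"
  assumes "c \<noteq> 0" and "\<And>x. g (x + b) = g x + c"
  shows "(\<Sum>x\<in>UNIV. add_char (g x)) = 0"
proof -
  have "(\<Sum>x\<in>UNIV. add_char (g x)) = (\<Sum>x\<in>UNIV. add_char (g (x + b)))"
    by (rule sum.reindex_bij_betw[OF bij_add_right, symmetric])
  also have "\<dots> = (\<Sum>x\<in>UNIV. add_char (g x)) * add_char c"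
    by (simp add: assms add_char_add sum_distrib_right)
  finally show ?thesis using assms(1) by (simp add: add_char_eq_1_iff)
qed

text \<open>A Wiener-Khinchin identity: the power spectrum of \<omega> to the \<open>f\<close> is
  the Fourier transform of its autocorrelation.\<close>

lemma cmod_walsh_square:
  fixes f :: "'q::finite_field \<Rightarrow> 'p::prime_card mod_ring"
  assumes card: "CARD('q) = CARD('p) ^ n"
  shows "complex_of_real ((cmod (walsh n f y))\<^sup>2) =
    (\<Sum>a\<in>UNIV. add_char (- abs_trace n (a * y) :: 'p mod_ring) *
      (\<Sum>x\<in>UNIV. add_char (deriv1 a f x)))"
proof -
  let ?t = "\<lambda>x. abs_trace n (x * y) :: 'p mod_ring"
  have "complex_of_real ((cmod (walsh n f y))\<^sup>2) = walsh n f y * cnj (walsh n f y)"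
    by (rule complex_norm_square)
  also have "\<dots> = (\<Sum>z\<in>UNIV. \<Sum>x\<in>UNIV. add_char (f x - ?t x - (f z - ?t z)))"
    unfolding walsh_def add_char_def[symmetric] add_char_diff[of "f _ - ?t _"] cnj_sum sum_product
    by (rule sum.swap)
  also have "\<dots> = (\<Sum>z\<in>UNIV. \<Sum>a\<in>UNIV. add_char (f (a + z) - ?t (a + z) - (f z - ?t z)))"
    by (intro sum.cong refl sum.reindex_bij_betw[OF bij_add_right, symmetric])
  \<comment> \<open>By additivity of the trace \<open>?t z\<close> cancels, which leaves a phase
    depending on \<open>a\<close> alone.\<close>
  also have "\<dots> = (\<Sum>z\<in>UNIV. \<Sum>a\<in>UNIV. add_char (- ?t a) * add_char (deriv1 a f z))"
    by (intro sum.cong refl)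
      (simp add: abs_trace_add[OF card] deriv1_def algebra_simps flip: add_char_add)
  also have "\<dots> = (\<Sum>a\<in>UNIV. \<Sum>z\<in>UNIV. add_char (- ?t a) * add_char (deriv1 a f z))"
    by (rule sum.swap)
  finally show ?thesis by (simp add: sum_distrib_left)
qed

theorem theorem1:
  fixes f :: "'q::finite_field \<Rightarrow> 'p::prime_card mod_ring" and n :: nat
  assumes "n \<ge> 1"
    and "CARD('q) = CARD('p) ^ n"
    and "cubic_like_bent f"
  shows "bent n f \<and> perfect_nonlinear f"
proof
  have shift: "\<exists>b c. c \<noteq> 0 \<and> (\<forall>x. deriv1 a f (x + b) = deriv1 a f x + c)" if a: "a \<noteq> 0" for a
  proof -
    obtain b c where "c \<noteq> 0" and c: "\<And>x. deriv2 a b f x = c"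
      using assms(3) a unfolding cubic_like_bent_def by blast
    \<comment> \<open>The second-order derivative is the difference of \<open>deriv1 a f\<close> in
      direction \<open>b\<close>.\<close>
    have "deriv1 a f (x + b) = deriv1 a f x + c" for x
      unfolding c[of x, symmetric] by (simp add: deriv1_def deriv2_def algebra_simps)
    with \<open>c \<noteq> 0\<close> show ?thesis by blast
  qed
  show "perfect_nonlinear f"
    unfolding perfect_nonlinear_def using shift balanced_if_shift by meson
  show "bent n f"
    unfolding bent_def
  proof
    fix y
    have trace_0: "abs_trace n (0 :: 'q) = (0 :: 'p mod_ring)"
      using abs_trace_add[OF assms(2), of 0 0] by (simp only: add_0_right add_cancel_right_right)
    have "(\<Sum>x\<in>UNIV. add_char (deriv1 a f x)) = 0" if a: "a \<noteq> 0" for a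
    proof -
      obtain b c where "c \<noteq> 0" and "\<And>x. deriv1 a f (x + b) = deriv1 a f x + c"
        using shift[OF a] by blast
      then show ?thesis by (rule sum_add_char_eq_0_if_shift)
    qed
    \<comment> \<open>For \<open>a = 0\<close> both the phase and the derivative are trivial, so the
      inner sum counts the elements of the field.\<close>
    then have "complex_of_real ((cmod (walsh n f y))\<^sup>2) =
        (\<Sum>a\<in>(UNIV :: 'q set). if a = 0 then of_nat CARD('q) else 0)"
      unfolding cmod_walsh_square[OF assms(2)]
      by (intro sum.cong) (auto simp: deriv1_def trace_0)
    then show "(cmod (walsh n f y))\<^sup>2 = real (CARD('p) ^ n)"
      unfolding assms(2)[symmetric] of_real_eq_iff[where 'a = complex, symmetric] by simp
  qed
qed

end
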